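(* For all integers $k \ge 2$ and $n\ge 1$, $E(n,k) = n+1$.
   Context: For integers $k,n\ge 1$, the generalised symmetric group $C_k \wr S_n$ is regarded as the subgroup of $GL_n(\mathbb{C})$ consisting of the matrices with exactly one non-zero entry in each row and each column, all of whose non-zero entries are $k$-th roots of unity. Let $V=\mathbb{C}^n$ be its natural representation, and for each integer $r\ge 0$ let $\psi_r$ be the character of $C_k\wr S_n$ on the exterior power $\Lambda^r V$ (so $\psi_0$ is the trivial character and $\psi_r=0$ for $r>n$). Define $E(n,k) = \dim_{\mathbb{C}} \mathrm{Span}_{\mathbb{C}}\{\psi_r : r\ge 0\}$, the dimension of the span inside the space of complex class functions on $C_k\wr S_n$. *)

theory Defs
  imports
    "Jordan_Normal_Form.Matrix"
    "HOL-Library.Function_Algebras"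
    "HOL-Library.FuncSet"
    "HOL-Combinatorics.Permutations"
begin

section \<open>Complex-valued functions as a vector space, and traces\<close>

global_interpretation fun_vs: vector_space "\<lambda>(c::complex) (f::'a \<Rightarrow> complex) x. c * f x"
  by unfold_locales (auto simp: fun_eq_iff algebra_simps)

text \<open>
  The trace of a linear endomorphism of a finite-dimensional subspace \<open>W\<close>: the sum of the diagonal
  entries of its matrix with respect to a basis of \<open>W\<close>.  The choice of the basis is immaterial,
  see the lemma \<open>subspace_trace_eq\<close> below.
\<close>

definition subspace_trace ::
    "('a \<Rightarrow> complex) set \<Rightarrow> (('a \<Rightarrow> complex) \<Rightarrow> 'a \<Rightarrow> complex) \<Rightarrow> complex" where
  "subspace_trace W f =
     (let B = (SOME B. fun_vs.independent B \<and> fun_vs.span B = W)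
      in \<Sum>b\<in>B. fun_vs.representation B (f b) b)"


section \<open>Exterior powers of the natural representation\<close>

text \<open>
  A tensor in the \<open>r\<close>-th tensor power of \<open>\<complex>\<^sup>n\<close> is given by its coordinates, indexed by the maps
  from \<open>{0..<r}\<close> to \<open>{0..<n}\<close>; the coordinate function vanishes off this index set.
\<close>

definition tensor_idx :: "nat \<Rightarrow> nat \<Rightarrow> (nat \<Rightarrow> nat) set" where
  "tensor_idx n r = {..<r} \<rightarrow>\<^sub>E {..<n}"

text \<open>
  The exterior power of \<open>\<complex>\<^sup>n\<close>, realised (in characteristic zero) as the subspace of antisymmetric
  tensors in the tensor power.
\<close>

definition ext_power :: "nat \<Rightarrow> nat \<Rightarrow> ((nat \<Rightarrow> nat) \<Rightarrow> complex) set" where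
  "ext_power n r =
     {t. (\<forall>i. i \<notin> tensor_idx n r \<longrightarrow> t i = 0) \<and>
         (\<forall>\<sigma>. \<sigma> permutes {..<r} \<longrightarrow>
            (\<forall>i\<in>tensor_idx n r. t (i \<circ> \<sigma>) = of_int (sign \<sigma>) * t i))}"

text \<open>
  The action of a matrix \<open>g\<close> on the tensor power, that is, \<open>g \<otimes> \<dots> \<otimes> g\<close> (\<open>r\<close> factors) in coordinates.
\<close>

definition tensor_action ::
    "nat \<Rightarrow> nat \<Rightarrow> complex mat \<Rightarrow> ((nat \<Rightarrow> nat) \<Rightarrow> complex) \<Rightarrow> (nat \<Rightarrow> nat) \<Rightarrow> complex" where
  "tensor_action n r g t = (\<lambda>i. if i \<in> tensor_idx n r
     then \<Sum>j\<in>tensor_idx n r. (\<Prod>a<r. g $$ (i a, j a)) * t j else 0)"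


section \<open>Generalised symmetric groups and the span of the exterior characters\<close>

definition gen_sym_group :: "nat \<Rightarrow> nat \<Rightarrow> complex mat set" where
  "gen_sym_group k n =
     {A \<in> carrier_mat n n.
        (\<forall>i<n. \<exists>!j. j < n \<and> A $$ (i, j) \<noteq> 0) \<and>
        (\<forall>j<n. \<exists>!i. i < n \<and> A $$ (i, j) \<noteq> 0) \<and>
        (\<forall>i<n. \<forall>j<n. A $$ (i, j) \<noteq> 0 \<longrightarrow> A $$ (i, j) ^ k = 1)}"

text \<open>
  Functions on the group are represented by functions on all matrices that vanish off the group.
\<close>

definition ext_char :: "nat \<Rightarrow> nat \<Rightarrow> nat \<Rightarrow> complex mat \<Rightarrow> complex" where
  "ext_char n k r = (\<lambda>g. if g \<in> gen_sym_group k n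
     then subspace_trace (ext_power n r) (tensor_action n r g) else 0)"

definition ext_char_dim :: "nat \<Rightarrow> nat \<Rightarrow> nat" where
  "ext_char_dim n k = fun_vs.dim (fun_vs.span (range (ext_char n k)))"


section \<open>Well-definedness\<close>

lemma subspace_trace_eq:
  fixes W :: "('a \<Rightarrow> complex) set" and f :: "('a \<Rightarrow> complex) \<Rightarrow> 'a \<Rightarrow> complex"
  assumes add: "\<And>v w. f (v + w) = f v + f w"
    and scale: "\<And>c v. f (\<lambda>x. c * v x) = (\<lambda>x. c * f v x)"
    and maps: "\<And>w. w \<in> W \<Longrightarrow> f w \<in> W"
    and C: "fun_vs.independent C" "fun_vs.span C = W" "finite C"
  shows "subspace_trace W f = (\<Sum>c\<in>C. fun_vs.representation C (f c) c)"
proof -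
  define B where "B = (SOME B. fun_vs.independent B \<and> fun_vs.span B = W)"
  have "fun_vs.independent B \<and> fun_vs.span B = W"
    unfolding B_def by (rule someI[of _ C]) (use C in simp)
  then have B: "fun_vs.independent B" "fun_vs.span B = W" by auto
  have finB: "finite B"
    using fun_vs.independent_span_bound[OF C(3) B(1)] B(2) C(2) fun_vs.span_superset[of B] by auto
  have BW: "B \<subseteq> W" and CW: "C \<subseteq> W"
    using B(2) C(2) fun_vs.span_superset by blast+
  have f0: "f 0 = 0"
    using add[of 0 0] by simp
  have fsum: "f (\<Sum>c\<in>S. (\<lambda>x. p c * c x)) = (\<Sum>c\<in>S. (\<lambda>x. p c * f c x))"
    if "finite S" for S :: "('a \<Rightarrow> complex) set" and p
    using that by induction (simp_all add: f0 f0[unfolded zero_fun_def] add scale del: plus_fun_apply)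
  have expand: "v = (\<Sum>d\<in>D. (\<lambda>x. fun_vs.representation D v d * d x))"
    if "fun_vs.independent D" "finite D" "fun_vs.span D = W" "v \<in> W"
    for D :: "('a \<Rightarrow> complex) set" and v
    using fun_vs.sum_representation_eq[OF that(1), of v D] that by simp
  have rep_comb: "fun_vs.representation D (\<Sum>s\<in>S. (\<lambda>x. p s * h s x)) d
      = (\<Sum>s\<in>S. p s * fun_vs.representation D (h s) d)"
    if "fun_vs.independent D" "fun_vs.span D = W" "\<And>s. s \<in> S \<Longrightarrow> h s \<in> W"
    for D S :: "('a \<Rightarrow> complex) set" and p and h :: "('a \<Rightarrow> complex) \<Rightarrow> 'a \<Rightarrow> complex" and d
  proof -
    have "(\<lambda>x. p s * h s x) \<in> fun_vs.span D" if "s \<in> S" for s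
      using fun_vs.span_scale[of "h s" D "p s"] that \<open>\<And>s. s \<in> S \<Longrightarrow> h s \<in> W\<close>
        \<open>fun_vs.span D = W\<close> by simp
    then have "fun_vs.representation D (\<Sum>s\<in>S. (\<lambda>x. p s * h s x)) d
        = (\<Sum>s\<in>S. fun_vs.representation D (\<lambda>x. p s * h s x) d)"
      using fun_vs.representation_sum[OF that(1), of S "\<lambda>s x. p s * h s x"] by simp
    also have "\<dots> = (\<Sum>s\<in>S. p s * fun_vs.representation D (h s) d)"
      using fun_vs.representation_scale[OF that(1)] that by (intro sum.cong) auto
    finally show ?thesis .
  qed
  have "(\<Sum>b\<in>B. fun_vs.representation B (f b) b)
      = (\<Sum>b\<in>B. \<Sum>c\<in>C. fun_vs.representation C b c * fun_vs.representation B (f c) b)"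
  proof (rule sum.cong[OF refl])
    fix b assume "b \<in> B"
    then have "b \<in> W" using BW by auto
    then have "f b = (\<Sum>c\<in>C. (\<lambda>x. fun_vs.representation C b c * f c x))"
      using arg_cong[OF expand[OF C(1,3,2)], of b f] fsum[OF C(3)] by simp
    then show "fun_vs.representation B (f b) b
        = (\<Sum>c\<in>C. fun_vs.representation C b c * fun_vs.representation B (f c) b)"
      using rep_comb[OF B, of C f "fun_vs.representation C b" b] CW maps by auto
  qed
  also have "\<dots> = (\<Sum>c\<in>C. \<Sum>b\<in>B. fun_vs.representation B (f c) b * fun_vs.representation C b c)"
    by (subst sum.swap) (simp add: mult.commute)
  also have "\<dots> = (\<Sum>c\<in>C. fun_vs.representation C (f c) c)"
  proof (rule sum.cong[OF refl])
    fix c assume "c \<in> C"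
    then have "f c \<in> W" using CW maps by auto
    then show "(\<Sum>b\<in>B. fun_vs.representation B (f c) b * fun_vs.representation C b c)
        = fun_vs.representation C (f c) c"
      using rep_comb[OF C(1,2), of B "\<lambda>b. b" "fun_vs.representation B (f c)" c] BW
        expand[OF B(1) finB B(2), of "f c"] by (simp add: subset_iff)
  qed
  finally show ?thesis
    by (simp add: subspace_trace_def B_def Let_def)
qed

lemma subspace_ext_power: "fun_vs.subspace (ext_power n r)"
  by (rule fun_vs.subspaceI) (auto simp: ext_power_def algebra_simps)

lemma tensor_action_add: "tensor_action n r g (t + u) = tensor_action n r g t + tensor_action n r g u"
  by (auto simp: tensor_action_def fun_eq_iff algebra_simps sum.distrib)

lemma tensor_action_scale: "tensor_action n r g (\<lambda>x. c * t x) = (\<lambda>x. c * tensor_action n r g t x)"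
  by (auto simp: tensor_action_def fun_eq_iff algebra_simps sum_distrib_left)

lemma tensor_idx_comp:
  assumes "i \<in> tensor_idx n r" "\<sigma> permutes {..<r}"
  shows "i \<circ> \<sigma> \<in> tensor_idx n r"
  using assms permutes_in_image[OF assms(2)]
  by (auto simp: tensor_idx_def PiE_def Pi_def extensional_def)

lemma tensor_action_ext_power:
  assumes "t \<in> ext_power n r"
  shows "tensor_action n r g t \<in> ext_power n r"
proof -
  have "tensor_action n r g t (i \<circ> \<sigma>) = of_int (sign \<sigma>) * tensor_action n r g t i"
    if \<sigma>: "\<sigma> permutes {..<r}" and i: "i \<in> tensor_idx n r" for \<sigma> i
  proof -
    have bij: "bij_betw (\<lambda>j. j \<circ> \<sigma>) (tensor_idx n r) (tensor_idx n r)"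
      by (rule bij_betwI[where g = "\<lambda>j. j \<circ> inv_into UNIV \<sigma>"])
        (use tensor_idx_comp \<sigma> permutes_inv[OF \<sigma>] in
          \<open>auto simp: comp_assoc permutes_inv_o[OF \<sigma>]\<close>)
    have "tensor_action n r g t (i \<circ> \<sigma>)
        = (\<Sum>j\<in>tensor_idx n r. (\<Prod>a<r. g $$ (i (\<sigma> a), j a)) * t j)"
      using tensor_idx_comp[OF i \<sigma>] by (simp add: tensor_action_def)
    also have "\<dots> = (\<Sum>j\<in>tensor_idx n r. (\<Prod>a<r. g $$ (i (\<sigma> a), j (\<sigma> a))) * t (j \<circ> \<sigma>))"
      by (subst sum.reindex_bij_betw[OF bij, symmetric]) simp
    also have "\<dots> = (\<Sum>j\<in>tensor_idx n r. (\<Prod>a<r. g $$ (i a, j a)) * (of_int (sign \<sigma>) * t j))"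
    proof (rule sum.cong[OF refl])
      fix j assume j: "j \<in> tensor_idx n r"
      have "(\<Prod>a<r. g $$ (i (\<sigma> a), j (\<sigma> a))) = (\<Prod>a<r. g $$ (i a, j a))"
        using prod.reindex_bij_betw[OF permutes_imp_bij[OF \<sigma>], of "\<lambda>a. g $$ (i a, j a)"] .
      moreover have "t (j \<circ> \<sigma>) = of_int (sign \<sigma>) * t j"
        using assms \<sigma> j by (simp add: ext_power_def)
      ultimately show "(\<Prod>a<r. g $$ (i (\<sigma> a), j (\<sigma> a))) * t (j \<circ> \<sigma>)
          = (\<Prod>a<r. g $$ (i a, j a)) * (of_int (sign \<sigma>) * t j)" by simp
    qed
    also have "\<dots> = of_int (sign \<sigma>) * tensor_action n r g t i"
      using i by (simp add: tensor_action_def sum_distrib_left algebra_simps)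
    finally show ?thesis .
  qed
  then show ?thesis
    by (auto simp: ext_power_def tensor_action_def)
qed

end

theory Submission
  imports Defs "HOL-Computational_Algebra.Polynomial"
begin

text \<open>
  On diagonal matrices, \<open>\<psi>\<^sub>r\<close> is the \<open>r\<close>-th elementary symmetric function, so
  \<open>\<Sum>\<^sub>r \<psi>\<^sub>r(g) X\<^sup>r = (1 + z X)\<^sup>m (1 + X)\<^sup>n\<^sup>-\<^sup>m\<close> if \<open>g\<close> has \<open>m\<close> diagonal entries \<open>z\<close> and the others
  are \<open>1\<close>.  A linear relation between \<open>\<psi>\<^sub>0, \<dots>, \<psi>\<^sub>n\<close> is a linear functional on the polynomials of
  degree at most \<open>n\<close> that vanishes on these products.  If \<open>z \<noteq> 1\<close>, then \<open>1\<close> and \<open>X\<close> are linear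
  combinations of \<open>1 + z X\<close> and \<open>1 + X\<close>, so the functional vanishes on all monomials.
\<close>

section \<open>Independence of indexed families of functions\<close>

lemma sum_fun_apply: "(\<Sum>a\<in>A. f a) x = (\<Sum>a\<in>A. f a x)"
  for f :: "'a \<Rightarrow> 'b \<Rightarrow> 'c::comm_monoid_add"
  by (induction A rule: infinite_finite_induct) auto

text \<open>\<open>fun_vs.independent\<close> concerns sets, which forget repetitions, so
  injectivity is recorded too; it lets the dimension be counted on the index set. A repetition
  \<open>f i = f j\<close> would itself be a relation, with coefficients 1 and -1.\<close>

lemma inj_on_and_independent_image:
  fixes f :: "'i \<Rightarrow> 'a \<Rightarrow> complex"
  assumes "finite I"
    and indep: "\<And>c i. (\<And>x. (\<Sum>i\<in>I. c i * f i x) = 0) \<Longrightarrow> i \<in> I \<Longrightarrow> c i = 0"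
  shows "inj_on f I" and "fun_vs.independent (f ` I)"
proof -
  show inj: "inj_on f I"
  proof (rule inj_onI, rule ccontr)
    fix i j assume ij: "i \<in> I" "j \<in> I" "f i = f j" "i \<noteq> j"
    define c :: "'i \<Rightarrow> complex" where "c = (\<lambda>l. of_bool (l = i) - of_bool (l = j))"
    have "(\<Sum>l\<in>I. c l * f l x) = 0" for x
      using assms(1) ij by (simp add: c_def left_diff_distrib sum_subtractf)
    from indep[of c, OF this ij(1)] ij(4) show False by (simp add: c_def)
  qed
  show "fun_vs.independent (f ` I)"
  proof
    assume "fun_vs.dependent (f ` I)"
    then obtain u v where u: "v \<in> f ` I" "u v \<noteq> 0" "(\<Sum>v\<in>f ` I. (\<lambda>x. u v * v x)) = 0"
      using fun_vs.dependent_finite[of "f ` I"] assms(1) by auto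
    have "(\<Sum>i\<in>I. u (f i) * f i x) = 0" for x
      using fun_cong[OF u(3), of x] by (simp add: sum_fun_apply sum.reindex[OF inj])
    from indep[of "\<lambda>i. u (f i)", OF this] u(1,2) show False by auto
  qed
qed


section \<open>A basis of the exterior power\<close>

text \<open>Increasing multi-indices represent the subsets. The restriction gives the value
  \<open>undefined\<close> outside the domain, as membership in \<open>tensor_idx\<close>
  demands.\<close>

definition subset_enum :: "nat set \<Rightarrow> nat \<Rightarrow> nat" where
  "subset_enum S = restrict (\<lambda>a. sorted_list_of_set S ! a) {..<card S}"

lemma bij_betw_subset_enum:
  assumes "finite S"
  shows "bij_betw (subset_enum S) {..<card S} S"
  using bij_betw_nth[of "sorted_list_of_set S" "{..<card S}" S] assms
  by (simp add: subset_enum_def)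

lemma subset_enum_in_tensor_idx:
  assumes "S \<subseteq> {..<n}" "card S = r"
  shows "subset_enum S \<in> tensor_idx n r"
proof -
  have "finite S" using assms(1) finite_subset by blast
  from bij_betw_imp_surj_on[OF bij_betw_subset_enum[OF this]] assms
  show ?thesis by (auto simp: tensor_idx_def PiE_def Pi_def subset_enum_def)
qed

text \<open>Both \<open>i\<close> and the increasing enumeration of its image are bijections from
  \<open>{..<r}\<close> onto that image, so they differ by a permutation.\<close>

lemma tensor_idx_factor:
  assumes i: "i \<in> tensor_idx n r" and inj: "inj_on i {..<r}"
  obtains \<sigma> where "\<sigma> permutes {..<r}" "i = subset_enum (i ` {..<r}) \<circ> \<sigma>"
proof -
  define S where "S = i ` {..<r}"
  have S: "finite S" "card S = r" using inj by (auto simp: S_def card_image)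
  let ?s = "subset_enum S"
  have s: "bij_betw ?s {..<r} S" using bij_betw_subset_enum[OF S(1)] S(2) by simp
  define h where "h = inv_into {..<r} ?s \<circ> i"
  have h: "bij_betw h {..<r} {..<r}" unfolding h_def
    by (rule bij_betw_trans[OF _ bij_betw_inv_into[OF s]]) (use inj in \<open>simp add: bij_betw_def S_def\<close>)
  define \<sigma> where "\<sigma> = (\<lambda>a. if a < r then h a else a)"
  have "bij_betw \<sigma> {..<r} {..<r}"
    using h by (subst bij_betw_cong[of _ \<sigma> h]) (auto simp: \<sigma>_def)
  then have "\<sigma> permutes {..<r}"
    by (rule bij_imp_permutes) (simp add: \<sigma>_def)
  moreover have "i = ?s \<circ> \<sigma>"
  proof
    fix a
    show "i a = (?s \<circ> \<sigma>) a"
    proof (cases "a < r")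
      case True
      then have "i a \<in> S" by (simp add: S_def)
      with True show ?thesis
        using bij_betw_inv_into_right[OF s] by (simp add: \<sigma>_def h_def)
    next
      \<comment> \<open>Beyond \<open>r\<close> the permutation is the identity and both sides are
        \<open>undefined\<close>.\<close>
      case False
      then show ?thesis
        using i S(2) by (auto simp: \<sigma>_def subset_enum_def tensor_idx_def PiE_def extensional_def)
    qed
  qed
  ultimately show thesis unfolding S_def by (rule that)
qed

text \<open>A permutation carries an injective index to an increasing one at the cost of a sign. An
  index with a repeated value is fixed by a transposition, which forces \<open>t i = - t i\<close>.
  Equality of antisymmetric tensors can thus be tested on increasing indices.\<close>

lemma ext_power_eq_zero:
  assumes t: "t \<in> ext_power n r"
    and zero: "\<And>S. S \<subseteq> {..<n} \<Longrightarrow> card S = r \<Longrightarrow> t (subset_enum S) = 0"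
  shows "t = 0"
proof
  fix i
  have alt: "t (j \<circ> \<sigma>) = of_int (sign \<sigma>) * t j"
    if "\<sigma> permutes {..<r}" "j \<in> tensor_idx n r" for \<sigma> j
    using t that by (simp add: ext_power_def)
  consider "i \<notin> tensor_idx n r" | "i \<in> tensor_idx n r" "inj_on i {..<r}"
    | "i \<in> tensor_idx n r" "\<not> inj_on i {..<r}" by blast
  then have "t i = 0"
  proof cases
    case 1
    then show ?thesis using t by (simp add: ext_power_def)
  next
    case 2
    then obtain \<sigma> where \<sigma>: "\<sigma> permutes {..<r}" "i = subset_enum (i ` {..<r}) \<circ> \<sigma>"
      by (rule tensor_idx_factor)
    have S: "i ` {..<r} \<subseteq> {..<n}" "card (i ` {..<r}) = r"
      using 2 by (auto simp: tensor_idx_def card_image)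
    show ?thesis
      using alt[OF \<sigma>(1) subset_enum_in_tensor_idx[OF S]] \<sigma>(2) zero[OF S] by simp
  next
    case 3
    then obtain a b where ab: "a < r" "b < r" "a \<noteq> b" "i a = i b"
      by (auto simp: inj_on_def)
    have p: "transpose a b permutes {..<r}"
      using ab by (intro permutes_swap_id) auto
    have "i \<circ> transpose a b = i"
      using ab by (auto simp: fun_eq_iff transpose_def)
    then show ?thesis
      using alt[OF p 3(1)] ab(3) by (simp add: sign_swap_id)
  qed
  then show "t i = 0 i" by simp
qed

text \<open>The antisymmetrisation of the tensor product of the standard basis vectors indexed by
  \<open>S\<close> in increasing order. The factor \<open>1/r!\<close> is omitted so that the
  coordinate at \<open>subset_enum S\<close> is 1.\<close>

definition wedge :: "nat set \<Rightarrow> (nat \<Rightarrow> nat) \<Rightarrow> complex" where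
  "wedge S i = (\<Sum>\<sigma> | \<sigma> permutes {..<card S}.
     if i = subset_enum S \<circ> \<sigma> then of_int (sign \<sigma>) else 0)"

lemma wedge_in_ext_power:
  assumes S: "S \<subseteq> {..<n}" "card S = r"
  shows "wedge S \<in> ext_power n r"
proof -
  have "wedge S i = 0" if "i \<notin> tensor_idx n r" for i
    unfolding wedge_def
    by (rule sum.neutral) (use that tensor_idx_comp[OF subset_enum_in_tensor_idx[OF S]] S in auto)
  moreover have "wedge S (i \<circ> \<tau>) = of_int (sign \<tau>) * wedge S i"
    if \<tau>: "\<tau> permutes {..<r}" for \<tau> i
  proof -
    \<comment> \<open>Substituting \<open>\<sigma> \<circ> \<tau>\<close> for
      \<open>\<sigma>\<close> in the defining sum restores the condition for \<open>i\<close> and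
      brings out \<open>sign \<tau>\<close>.\<close>
    have "i \<circ> \<tau> = subset_enum S \<circ> (\<sigma> \<circ> \<tau>) \<longleftrightarrow> i = subset_enum S \<circ> \<sigma>" for \<sigma>
      by (metis comp_assoc comp_id permutes_inv_o(1)[OF \<tau>])
    moreover have "sign (\<sigma> \<circ> \<tau>) = sign \<sigma> * sign \<tau>" if "\<sigma> permutes {..<r}" for \<sigma>
      using that \<tau> by (intro sign_compose permutation_permutes[THEN iffD2] exI[of _ "{..<r}"]) auto
    ultimately show ?thesis
      unfolding wedge_def S(2)
      by (subst sum_permutations_compose_right[OF \<tau>])
        (auto simp: sum_distrib_left intro!: sum.cong)
  qed
  ultimately show ?thesis by (auto simp: ext_power_def)
qed

text \<open>Enumerations that differ by a permutation have the same image, and injectivity then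
  makes the permutation trivial, so only the identity can contribute. Evaluations at increasing
  indices are therefore dual to the wedges.\<close>

lemma wedge_subset_enum:
  assumes "finite S" "finite T" "card S = card T"
  shows "wedge S (subset_enum T) = of_bool (S = T)"
proof -
  let ?r = "card S"
  have S: "bij_betw (subset_enum S) {..<?r} S" and T: "bij_betw (subset_enum T) {..<?r} T"
    using bij_betw_subset_enum[OF assms(1)] bij_betw_subset_enum[OF assms(2)] assms(3) by simp_all
  have "subset_enum T = subset_enum S \<circ> \<sigma> \<longleftrightarrow> S = T \<and> \<sigma> = id" if \<sigma>: "\<sigma> permutes {..<?r}" for \<sigma>
  proof
    assume eq: "subset_enum T = subset_enum S \<circ> \<sigma>"
    have "T = subset_enum T ` {..<?r}"
      using T by (simp add: bij_betw_def)
    also have "\<dots> = subset_enum S ` \<sigma> ` {..<?r}"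
      by (simp add: eq image_comp)
    also have "\<dots> = S"
      using S permutes_image[OF \<sigma>] by (simp add: bij_betw_def)
    finally have ST: "T = S" .
    have "\<sigma> a = a" for a
    proof (cases "a < ?r")
      case True
      then have "\<sigma> a < ?r" using permutes_in_image[OF \<sigma>] by simp
      moreover have "subset_enum S (\<sigma> a) = subset_enum S a"
        using fun_cong[OF eq, of a] ST by simp
      ultimately show ?thesis
        using S True by (auto simp: bij_betw_def dest: inj_onD)
    next
      case False
      then show ?thesis using permutes_not_in[OF \<sigma>] by simp
    qed
    with ST show "S = T \<and> \<sigma> = id" by auto
  qed auto
  then have "wedge S (subset_enum T) =
      (\<Sum>\<sigma> | \<sigma> permutes {..<?r}. if \<sigma> = id then of_bool (S = T) else 0)"
    unfolding wedge_def by (intro sum.cong) auto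
  then show ?thesis
    by (simp add: finite_permutations permutes_id)
qed

lemma wedge_basis:
  fixes n r :: nat
  defines "I \<equiv> {S. S \<subseteq> {..<n} \<and> card S = r}"
  shows "finite I" "inj_on wedge I" "fun_vs.independent (wedge ` I)"
    "fun_vs.span (wedge ` I) = ext_power n r"
proof -
  show fin: "finite I"
    by (rule finite_subset[of _ "Pow {..<n}"]) (auto simp: I_def)
  have eval: "(\<Sum>S\<in>I. c S * wedge S (subset_enum T)) = c T" if "T \<in> I" for c T
  proof -
    have "(\<Sum>S\<in>I. c S * wedge S (subset_enum T)) = (\<Sum>S\<in>I. c S * of_bool (S = T))"
      using that finite_subset[of _ "{..<n}"]
      by (intro sum.cong) (auto simp: I_def wedge_subset_enum)
    then show ?thesis using that fin by simp
  qed
  have indep: "c T = 0" if "\<And>x. (\<Sum>S\<in>I. c S * wedge S x) = 0" "T \<in> I" for c T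
    using eval[OF that(2), of c] that(1) by simp
  show "inj_on wedge I" "fun_vs.independent (wedge ` I)"
    by (rule inj_on_and_independent_image[OF fin]; fact indep)+
  show "fun_vs.span (wedge ` I) = ext_power n r"
  proof
    show "fun_vs.span (wedge ` I) \<subseteq> ext_power n r"
      by (rule fun_vs.span_minimal[OF _ subspace_ext_power])
        (auto simp: I_def wedge_in_ext_power)
  next
    show "ext_power n r \<subseteq> fun_vs.span (wedge ` I)"
    proof
      fix t assume t: "t \<in> ext_power n r"
      \<comment> \<open>By duality \<open>u\<close> agrees with \<open>t\<close> at every increasing
        index, so their difference is zero.\<close>
      define u where "u = (\<Sum>S\<in>I. (\<lambda>x. t (subset_enum S) * wedge S x))"
      have u: "u \<in> fun_vs.span (wedge ` I)"
        unfolding u_def by (intro fun_vs.span_sum fun_vs.span_scale fun_vs.span_base) auto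
      have "u \<in> ext_power n r"
        unfolding u_def
        by (intro fun_vs.subspace_sum[OF subspace_ext_power]
            fun_vs.subspace_scale[OF subspace_ext_power])
          (auto simp: I_def wedge_in_ext_power)
      then have "t - u \<in> ext_power n r"
        using t fun_vs.subspace_diff[OF subspace_ext_power] by blast
      then have "t - u = 0"
        by (rule ext_power_eq_zero) (use eval in \<open>simp add: u_def sum_fun_apply I_def\<close>)
      with u show "t \<in> fun_vs.span (wedge ` I)" by simp
    qed
  qed
qed


section \<open>Values of the exterior characters\<close>

definition diagonal :: "nat \<Rightarrow> (nat \<Rightarrow> complex) \<Rightarrow> complex mat" where
  "diagonal n d = mat n n (\<lambda>(i, j). if i = j then d i else 0)"

lemma tensor_action_diagonal:
  assumes i: "i \<in> tensor_idx n r"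
  shows "tensor_action n r (diagonal n d) t i = (\<Prod>a<r. d (i a)) * t i"
proof -
  have bound: "j a < n" if "j \<in> tensor_idx n r" "a < r" for j a
    using that by (auto simp: tensor_idx_def)
  have "(\<Prod>a<r. diagonal n d $$ (i a, j a)) = (if j = i then \<Prod>a<r. d (i a) else 0)"
    if j: "j \<in> tensor_idx n r" for j
  proof (cases "j = i")
    case True
    then show ?thesis
      using bound[OF i] by (auto simp: diagonal_def intro!: prod.cong)
  next
    case False
    \<comment> \<open>Indices are extensional, so distinct ones differ at some position below
      \<open>r\<close>; the matrix entry there is off the diagonal and kills the product.\<close>
    then obtain a where "a < r" "i a \<noteq> j a"
      using i j PiE_ext[of j "{..<r}" "\<lambda>_. {..<n}" i] by (force simp: tensor_idx_def)
    then have "diagonal n d $$ (i a, j a) = 0"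
      using bound[OF i] bound[OF j] by (simp add: diagonal_def)
    with \<open>a < r\<close> False show ?thesis by auto
  qed
  moreover have "finite (tensor_idx n r)"
    by (simp add: tensor_idx_def finite_PiE)
  ultimately show ?thesis
    using i by (simp add: tensor_action_def if_distrib[of "\<lambda>x. x * _"] cong: if_cong)
qed

text \<open>Both sides are antisymmetric, so comparison at increasing indices suffices. There
  \<open>wedge S\<close> vanishes except at \<open>subset_enum S\<close>, where the eigenvalue is
  the product over \<open>S\<close>.\<close>

lemma tensor_action_diagonal_wedge:
  assumes S: "S \<subseteq> {..<n}" "card S = r"
  shows "tensor_action n r (diagonal n d) (wedge S) = (\<lambda>x. (\<Prod>a\<in>S. d a) * wedge S x)"
proof -
  let ?u = "tensor_action n r (diagonal n d) (wedge S)" and ?v = "\<lambda>x. (\<Prod>a\<in>S. d a) * wedge S x"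
  have "?u - ?v = 0"
  proof (rule ext_power_eq_zero)
    show "?u - ?v \<in> ext_power n r"
      using wedge_in_ext_power[OF S]
      by (intro fun_vs.subspace_diff[OF subspace_ext_power] tensor_action_ext_power
          fun_vs.subspace_scale[OF subspace_ext_power])
  next
    fix T assume T: "T \<subseteq> {..<n}" "card T = r"
    have fin: "finite S" "finite T"
      using S T finite_subset by blast+
    have "(\<Prod>a<r. d (subset_enum S a)) = (\<Prod>a\<in>S. d a)"
      using prod.reindex_bij_betw[OF bij_betw_subset_enum[OF fin(1)], of d] S(2) by simp
    then have "(\<Prod>a<r. d (subset_enum T a)) = (\<Prod>a\<in>S. d a)" if "S = T"
      using that by simp
    then show "(?u - ?v) (subset_enum T) = 0"
      using fin S T
      by (auto simp: tensor_action_diagonal subset_enum_in_tensor_idx wedge_subset_enum)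
  qed
  then show ?thesis by simp
qed

text \<open>The wedges form an eigenbasis, so the trace is the sum of their eigenvalues: the
  elementary symmetric function of degree \<open>r\<close> in the diagonal entries.\<close>

lemma subspace_trace_diagonal:
  "subspace_trace (ext_power n r) (tensor_action n r (diagonal n d)) =
     (\<Sum>S | S \<subseteq> {..<n} \<and> card S = r. \<Prod>a\<in>S. d a)"
proof -
  let ?I = "{S. S \<subseteq> {..<n} \<and> card S = r}" and ?f = "tensor_action n r (diagonal n d)"
  note basis = wedge_basis[where n = n and r = r]
  have "subspace_trace (ext_power n r) ?f =
      (\<Sum>w\<in>wedge ` ?I. fun_vs.representation (wedge ` ?I) (?f w) w)"
    by (rule subspace_trace_eq)
      (use basis in \<open>auto simp: tensor_action_add tensor_action_scale tensor_action_ext_power\<close>)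
  also have "\<dots> = (\<Sum>S\<in>?I. fun_vs.representation (wedge ` ?I) (?f (wedge S)) (wedge S))"
    using basis(2) by (simp add: sum.reindex)
  also have "\<dots> = (\<Sum>S\<in>?I. \<Prod>a\<in>S. d a)"
  proof (rule sum.cong[OF refl])
    fix S assume S: "S \<in> ?I"
    then have "wedge S \<in> wedge ` ?I" by blast
    then show "fun_vs.representation (wedge ` ?I) (?f (wedge S)) (wedge S) = (\<Prod>a\<in>S. d a)"
      using S fun_vs.span_base[of "wedge S" "wedge ` ?I"]
      by (simp add: tensor_action_diagonal_wedge fun_vs.representation_scale[OF basis(3)]
          fun_vs.representation_basis[OF basis(3)])
  qed
  finally show ?thesis .
qed

text \<open>No subset of \<open>{..<n}\<close> has more than \<open>n\<close> elements, so the wedge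
  basis is empty and the trace is an empty sum.\<close>

lemma ext_char_eq_zero:
  assumes "n < r"
  shows "ext_char n k r = 0"
proof -
  have "{S. S \<subseteq> {..<n} \<and> card S = r} = {}"
    using assms by (auto dest!: card_mono[OF finite_lessThan])
  then have "fun_vs.span {} = ext_power n r"
    using wedge_basis(4)[of n r] by (simp only: image_empty)
  then have "subspace_trace (ext_power n r) (tensor_action n r g) = 0" for g
    by (subst subspace_trace_eq[where C = "{}"])
      (auto simp: fun_vs.independent_empty tensor_action_add tensor_action_scale tensor_action_ext_power)
  then show ?thesis by (auto simp: ext_char_def)
qed

lemma diagonal_in_gen_sym_group:
  assumes "k > 0" and d: "\<And>i. i < n \<Longrightarrow> d i ^ k = 1"
  shows "diagonal n d \<in> gen_sym_group k n"
proof -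
  have "d i \<noteq> 0" if "i < n" for i
    using d[OF that] assms(1) by (auto simp: power_0_left)
  then have "diagonal n d $$ (i, j) \<noteq> 0 \<longleftrightarrow> j = i" if "i < n" "j < n" for i j
    using that by (simp add: diagonal_def)
  then show ?thesis
    using d by (auto simp: gen_sym_group_def) (auto simp: diagonal_def)
qed

text \<open>Expanding the product amounts to choosing the set \<open>S\<close> of factors that
  contribute \<open>d i\<close> times the variable instead of 1; the degree of the resulting term is
  \<open>card S\<close>.\<close>

lemma coeff_prod_linear:
  fixes d :: "'i \<Rightarrow> 'a::comm_ring_1"
  assumes "finite A"
  shows "coeff (\<Prod>i\<in>A. [:1, d i:]) r = (\<Sum>S | S \<subseteq> A \<and> card S = r. \<Prod>i\<in>S. d i)"
proof -
  have "(\<Prod>i\<in>A. [:1, d i:]) = (\<Prod>i\<in>A. monom (d i) 1 + 1)"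
    by (intro prod.cong) (auto simp: monom_altdef one_pCons)
  also have "\<dots> = (\<Sum>S\<in>Pow A. \<Prod>i\<in>S. monom (d i) 1)"
    using assms by (simp add: prod_add)
  also have "\<dots> = (\<Sum>S\<in>Pow A. monom (\<Prod>i\<in>S. d i) (card S))"
  proof (rule sum.cong[OF refl])
    fix S assume "S \<in> Pow A"
    then have "finite S" using assms finite_subset by auto
    then show "(\<Prod>i\<in>S. monom (d i) 1) = monom (\<Prod>i\<in>S. d i) (card S)"
      by induction (auto simp: mult_monom)
  qed
  finally have "coeff (\<Prod>i\<in>A. [:1, d i:]) r =
      (\<Sum>S\<in>Pow A. if card S = r then \<Prod>i\<in>S. d i else 0)"
    by (simp add: coeff_sum)
  also have "\<dots> = (\<Sum>S\<in>Pow A \<inter> {S. card S = r}. \<Prod>i\<in>S. d i)"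
    using assms by (simp add: sum.inter_restrict)
  also have "Pow A \<inter> {S. card S = r} = {S. S \<subseteq> A \<and> card S = r}" by auto
  finally show ?thesis .
qed

lemma ext_char_diagonal:
  assumes "k > 0" and "\<And>i. i < n \<Longrightarrow> d i ^ k = 1"
  shows "ext_char n k r (diagonal n d) = coeff (\<Prod>i<n. [:1, d i:]) r"
  using diagonal_in_gen_sym_group[of k n d] assms
  by (simp add: ext_char_def subspace_trace_diagonal coeff_prod_linear)


section \<open>Linear independence\<close>

lemma functional_monom_eq_zero:
  fixes L :: "'a::field poly \<Rightarrow> 'a" and z :: 'a
  assumes "z \<noteq> 1"
    and add: "\<And>p q. L (p + q) = L p + L q"
    and smult: "\<And>c p. L (smult c p) = c * L p"
    and vanish: "\<And>m. m \<le> n \<Longrightarrow> L ([:1, z:] ^ m * [:1, 1:] ^ (n - m)) = 0"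
  shows "a \<le> n \<Longrightarrow> L (monom 1 a) = 0"
proof -
  have diff: "L (p - q) = L p - L q" for p q
    using add[of "p - q" q] by simp
  have cancel: "L q = 0" if "L (smult (1 - z) q) = 0" for q
    using that \<open>z \<noteq> 1\<close> by (simp add: smult)
  \<comment> \<open>Induction on the number of factors X, keeping \<open>n\<close> linear factors in
    total so that the base case is \<open>vanish\<close>. The identity
    \<open>(1 - z) X = (1 + X) - (1 + z X)\<close> trades one X for another factor.\<close>
  have step: "L ([:0, 1:] ^ a * [:1, z:] ^ b * [:1, 1:] ^ c) = 0" if "a + b + c = n" for a b c
    using that
  proof (induction a arbitrary: b c)
    case 0
    then have "c = n - b" by simp
    then show ?case using vanish[of b] 0 by simp
  next
    case (Suc a)
    let ?p = "[:0, 1:] ^ a * [:1, z:] ^ b * [:1, 1:] ^ c"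
    have "smult (1 - z) [:0, 1:] = [:1, 1:] - [:1, z:]" by simp
    then have "smult (1 - z) ([:0, 1:] * ?p) = [:1, 1:] * ?p - [:1, z:] * ?p"
      by (metis left_diff_distrib mult_smult_left)
    also have "\<dots> = [:0, 1:] ^ a * [:1, z:] ^ b * [:1, 1:] ^ Suc c
        - [:0, 1:] ^ a * [:1, z:] ^ Suc b * [:1, 1:] ^ c"
      by (simp only: power_Suc mult_ac)
    finally have "L (smult (1 - z) ([:0, 1:] * ?p)) = 0"
      using Suc.IH[of b "Suc c"] Suc.IH[of "Suc b" c] Suc.prems by (simp only: diff) simp
    from cancel[OF this] show ?case by (simp only: power_Suc mult_ac)
  qed
  \<comment> \<open>Here \<open>e\<close> counts the factors missing from \<open>n\<close>. The
    identity \<open>1 - z = (1 + z X) - z (1 + X)\<close> supplies one of them, so \<open>e\<close>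
    drops to 0 and the previous claim applies.\<close>
  have all: "L ([:0, 1:] ^ a * [:1, z:] ^ b * [:1, 1:] ^ c) = 0" if "a + b + c + e = n" for a b c e
    using that
  proof (induction e arbitrary: b c)
    case 0
    then show ?case using step by simp
  next
    case (Suc e)
    let ?p = "[:0, 1:] ^ a * [:1, z:] ^ b * [:1, 1:] ^ c"
    have one: "[:1 - z:] = [:1, z:] - smult z [:1, 1:]" by simp
    have "smult (1 - z) ?p = [:1 - z:] * ?p" by simp
    also have "\<dots> = [:1, z:] * ?p - smult z ([:1, 1:] * ?p)"
      by (simp only: one left_diff_distrib mult_smult_left)
    also have "\<dots> = [:0, 1:] ^ a * [:1, z:] ^ Suc b * [:1, 1:] ^ c
        - smult z ([:0, 1:] ^ a * [:1, z:] ^ b * [:1, 1:] ^ Suc c)"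
      by (simp only: power_Suc mult_ac)
    finally have "L (smult (1 - z) ?p) = 0"
      using Suc.IH[of b "Suc c"] Suc.IH[of "Suc b" c] Suc.prems by (simp only: diff smult) simp
    from cancel[OF this] show ?case .
  qed
  show "L (monom 1 a) = 0" if "a \<le> n"
    using all[of a 0 0 "n - a"] that by (simp add: monom_altdef)
qed

lemma ext_char_independent:
  assumes "k \<ge> 2" and rel: "\<And>g. (\<Sum>r\<le>n. c r * ext_char n k r g) = 0" and "a \<le> n"
  shows "c a = 0"
proof -
  \<comment> \<open>There are \<open>k\<close> distinct \<open>k\<close>-th roots of unity, hence
    one other than 1 when \<open>k \<ge> 2\<close>.\<close>
  have "\<not> {z::complex. z ^ k = 1} \<subseteq> {1}"
    using card_mono[of "{1::complex}" "{z. z ^ k = 1}"] card_roots_unity_eq[of k] assms(1) by auto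
  then obtain z :: complex where z: "z ^ k = 1" "z \<noteq> 1" by auto
  \<comment> \<open>The relation, read as a functional on polynomials. Its value at a generating
    polynomial is the relation evaluated at a diagonal matrix, and its value at
    \<open>monom 1 a\<close> is \<open>c a\<close>.\<close>
  define L where "L p = (\<Sum>r\<le>n. c r * coeff p r)" for p
  have "L ([:1, z:] ^ m * [:1, 1:] ^ (n - m)) = 0" if "m \<le> n" for m
  proof -
    define d where "d = (\<lambda>i. if i < m then z else 1)"
    have split: "{..<n} = {..<m} \<union> {m..<n}" using that by auto
    have "(\<Prod>i<n. [:1, d i:]) = (\<Prod>i<m. [:1, d i:]) * (\<Prod>i=m..<n. [:1, d i:])"
      unfolding split by (rule prod.union_disjoint) auto
    also have "\<dots> = [:1, z:] ^ m * [:1, 1:] ^ (n - m)"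
      by (simp add: d_def)
    finally show ?thesis
      using rel[of "diagonal n d"] ext_char_diagonal[of k n d] assms(1) z(1)
      by (simp add: L_def d_def)
  qed
  from functional_monom_eq_zero[of z L n, OF z(2) _ _ this \<open>a \<le> n\<close>]
  have "L (monom 1 a) = 0"
    by (simp add: L_def sum.distrib sum_distrib_left algebra_simps)
  then show ?thesis using \<open>a \<le> n\<close> by (simp add: L_def if_distrib cong: if_cong)
qed

theorem corollary7:
  fixes n k :: nat
  assumes "k \<ge> 2" and "n \<ge> 1"
  shows "ext_char_dim n k = n + 1"
proof -
  let ?B = "ext_char n k ` {..n}"
  have indep: "c a = 0" if "\<And>g. (\<Sum>r\<in>{..n}. c r * ext_char n k r g) = 0" "a \<in> {..n}" for c a
    using ext_char_independent[OF assms(1) that(1)] that(2) by simp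
  have B: "inj_on (ext_char n k) {..n}" "fun_vs.independent ?B"
    by (rule inj_on_and_independent_image[OF finite_atMost]; fact indep)+
  \<comment> \<open>The characters of index above \<open>n\<close> vanish, so the
    \<open>n + 1\<close> independent ones already span.\<close>
  have "range (ext_char n k) \<subseteq> fun_vs.span ?B"
  proof clarify
    fix r
    show "ext_char n k r \<in> fun_vs.span ?B"
      by (cases "r \<le> n")
        (auto simp: ext_char_eq_zero intro: fun_vs.span_base fun_vs.span_zero)
  qed
  then have "fun_vs.span (range (ext_char n k)) = fun_vs.span ?B"
    by (intro fun_vs.span_eq[THEN iffD2] conjI) (auto intro: fun_vs.span_base)
  then have "ext_char_dim n k = card ?B"
    using fun_vs.dim_eq_card_independent[OF B(2)] by (simp add: ext_char_dim_def fun_vs.dim_span)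
  then show ?thesis by (simp add: card_image[OF B(1)])
qed

end
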